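(* Let $1\le k\le n$, $0<\alpha<1$, and let $P_1,\dots,P_n$ be $p$-values for null hypotheses $H_1,\dots,H_n$. Assume that, under the null hypotheses, $(P_1,\dots,P_n)$ have an $\mathrm{MTP}_2$ distribution in addition to having identical $k$th-order joint distributions, with $G_k$ the c.d.f. of the maximum of any $k$ of them under the null hypotheses. Let $\alpha_k\le\cdots\le\alpha_n$ be defined by $G_k(\alpha_i)=\alpha\big/\binom{n+k-i}{k}$, $i=k,\dots,n$. Consider the generalized stepup procedure based on these critical values: reject any $H_{(i)}$ for which $i\le\max_{1\le j\le n}\{j:P_{j:n}\le\alpha_{\max(j,k)}\}$ if the maximum exists (accepting the remaining hypotheses), and otherwise accept all $H_{(i)}$. This procedure controls the $k$-FWER at $\alpha$.
   Context: $P_{1:n}\le\cdots\le P_{n:n}$ are the ordered $p$-values, and $H_{(1)},\dots,H_{(n)}$ are the correspondingly ordered null hypotheses. Let $I_0\subseteq\{1,\dots,n\}$ be the (unknown, arbitrary) set of indices of true null hypotheses. The $k$-FWER of a procedure is the probability that it rejects at least $k$ of the true null hypotheses $H_i$, $i\in I_0$. "Controls the $k$-FWER at $\alpha$" is meant in the strong sense: the $k$-FWER is at most $\alpha$ for every configuration $I_0$ of true and false null hypotheses (it is trivially $0$ if $|I_0|<k$). The distributional assumptions under the null hypotheses mean: the vector $(P_i)_{i\in I_0}$ of $p$-values of the true null hypotheses is $\mathrm{MTP}_2$; and for all $J\subseteq I_0$ with $|J|=k$ the vectors $(P_j)_{j\in J}$ have the same joint distribution, not depending on $J$ or $I_0$,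 with $G_k(u)=\Pr\{\max_{j\in J}P_j\le u\}$ for any such $J$. Each $P_i$ is uniform on $(0,1)$ when $H_i$ is true. $\mathrm{MTP}_2$ (multivariate totally positive of order two): a function $f\ge 0$ on a product of totally ordered spaces is $\mathrm{MTP}_2$ if $f(\mathbf{x}\vee\mathbf{y})f(\mathbf{x}\wedge\mathbf{y})\ge f(\mathbf{x})f(\mathbf{y})$ for all $\mathbf{x},\mathbf{y}$, where $\vee,\wedge$ are the coordinatewise maximum and minimum. A random vector is $\mathrm{MTP}_2$ if it has a density, with respect to a product of $\sigma$-finite measures on the coordinates, that is $\mathrm{MTP}_2$. *)

theory Defs
  imports "HOL-Probability.Probability"
begin

text \<open>The product space is the set of extensional functions on the index set \<open>I\<close>.\<close>

definition MTP2_on :: "'i set \<Rightarrow> (('i \<Rightarrow> 'b::linorder) \<Rightarrow> real) \<Rightarrow> bool" where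
  "MTP2_on I f \<longleftrightarrow>
     (\<forall>x \<in> (\<Pi>\<^sub>E i\<in>I. UNIV). 0 \<le> f x) \<and>
     (\<forall>x \<in> (\<Pi>\<^sub>E i\<in>I. UNIV). \<forall>y \<in> (\<Pi>\<^sub>E i\<in>I. UNIV).
        f x * f y \<le> f (\<lambda>i\<in>I. max (x i) (y i)) * f (\<lambda>i\<in>I. min (x i) (y i)))"

definition MTP2_vector :: "'a measure \<Rightarrow> 'i set \<Rightarrow> ('i \<Rightarrow> 'a \<Rightarrow> real) \<Rightarrow> bool" where
  "MTP2_vector M I X \<longleftrightarrow>
     (\<exists>(N :: 'i \<Rightarrow> real measure) f.
        (\<forall>i\<in>I. sigma_finite_measure (N i) \<and> sets (N i) = sets borel) \<and>
        MTP2_on I f \<and>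
        distributed M (Pi\<^sub>M I N) (\<lambda>\<omega>. \<lambda>i\<in>I. X i \<omega>) (\<lambda>x. ennreal (f x)))"

text \<open>To compare the laws of \<open>(X\<^sub>j)\<close>, \<open>j \<in> J\<close>, for different finite sets \<open>J\<close> of the same size,
  the elements of \<open>J\<close> are listed in increasing order. No exchangeability is
  implied by equality of these laws.\<close>

definition joint_law :: "'a measure \<Rightarrow> (nat \<Rightarrow> 'a \<Rightarrow> real) \<Rightarrow> nat set \<Rightarrow> (nat \<Rightarrow> real) measure" where
  "joint_law M X J =
     distr M (\<Pi>\<^sub>M l\<in>{..<card J}. borel) (\<lambda>\<omega>. \<lambda>l\<in>{..<card J}. X (sorted_list_of_set J ! l) \<omega>)"

text \<open>A statistical model is a family of distributions \<open>M \<theta>\<close> of the data; the null hypothesis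
  \<open>H i\<close> is the set of parameters for which it is true.\<close>

definition true_nulls :: "nat \<Rightarrow> (nat \<Rightarrow> 't set) \<Rightarrow> 't \<Rightarrow> nat set" where
  "true_nulls n H \<theta> = {i \<in> {1..n}. \<theta> \<in> H i}"

text \<open>\<open>ord_index n p j\<close> is the index of the \<open>j\<close>-th ordered hypothesis (\<open>1 \<le> j \<le> n\<close>). Ties are broken
  by the original index; for critical values nondecreasing in \<open>j\<close>, as for any stepup rule, the
  set of rejected hypotheses does not depend on how ties are broken.\<close>

definition ord_index :: "nat \<Rightarrow> (nat \<Rightarrow> real) \<Rightarrow> nat \<Rightarrow> nat" where
  "ord_index n p j = sort_key p [1..<Suc n] ! (j - 1)"

definition ord_pvalue :: "nat \<Rightarrow> (nat \<Rightarrow> real) \<Rightarrow> nat \<Rightarrow> real" where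
  "ord_pvalue n p j = p (ord_index n p j)"

definition gen_stepup :: "nat \<Rightarrow> nat \<Rightarrow> (nat \<Rightarrow> real) \<Rightarrow> (nat \<Rightarrow> real) \<Rightarrow> nat set" where
  "gen_stepup k n a p =
     (let S = {j \<in> {1..n}. ord_pvalue n p j \<le> a (max j k)}
      in if S = {} then {} else ord_index n p ` {i \<in> {1..n}. i \<le> Max S})"

text \<open>\<open>R \<omega>\<close> is the set of hypotheses rejected on observing \<open>\<omega>\<close>. For \<open>R = gen_stepup k n a\<close> applied
  to random variables the event below is measurable, since it is decided by finitely many
  comparisons.\<close>

definition kFWER :: "nat \<Rightarrow> 'a measure \<Rightarrow> nat set \<Rightarrow> ('a \<Rightarrow> nat set) \<Rightarrow> real" where
  "kFWER k M I0 R = measure M {\<omega> \<in> space M. k \<le> card (R \<omega> \<inter> I0)}"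

definition controls_kFWER ::
  "nat \<Rightarrow> nat \<Rightarrow> 't set \<Rightarrow> ('t \<Rightarrow> 'a measure) \<Rightarrow> (nat \<Rightarrow> 't set) \<Rightarrow> ('a \<Rightarrow> nat set) \<Rightarrow> real \<Rightarrow> bool" where
  "controls_kFWER k n \<Theta> M H R \<alpha> \<longleftrightarrow>
     (\<forall>\<theta>\<in>\<Theta>. kFWER k (M \<theta>) (true_nulls n H \<theta>) R \<le> \<alpha>)"

end

theory Submission
  imports Defs
begin

text \<open>Let \<open>m\<close> be the number of true nulls. Rejecting \<open>v \<ge> k\<close> of them forces at least \<open>v\<close> null
  \<open>p\<close>-values below \<open>\<beta>\<^sub>v = \<alpha>\<^bsub>n-m+v\<^esub>\<close>, so the claim reduces to a Simes-type inequality for the null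
  \<open>p\<close>-values. Let \<open>R\<close> be the largest \<open>j\<close> such that at least \<open>j\<close> of them are \<open>\<le> \<beta>\<^sub>j\<close>.
  On \<open>R = j\<close> exactly \<open>j\<close> of them are \<open>\<le> \<beta>\<^sub>j\<close>, so exactly
  \<open>j choose k\<close> of the \<open>k\<close>-subsets \<open>J\<close> have maximum \<open>P\<^sub>J \<le> \<beta>\<^sub>j\<close>. Hence the probability of \<open>R \<ge> k\<close> is
  the sum over \<open>J\<close> and \<open>j\<close> of \<open>Pr(R = j | P\<^sub>J \<le> \<beta>\<^sub>j) G(\<beta>\<^sub>j) / (j choose k)\<close>. The last two factors
  are at most \<open>\<alpha> / (m choose k)\<close>, and the conditional probabilities sum to at most one over \<open>j\<close>:
  \<open>R \<ge> j\<close> is a decreasing event, so by the four functions theorem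
  \<open>Pr(R \<ge> j | P\<^sub>J \<le> u)\<close> is nonincreasing in \<open>u\<close> and the sum telescopes.\<close>

subsection \<open>The four functions theorem for product measures\<close>

text \<open>For finite values, expanding \<open>(c - a) * (c - b) \<ge> 0\<close> gives
  \<open>c * (a + b) \<le> c * c + a * b \<le> c * (c + d)\<close>, and \<open>c\<close> cancels
  unless it is zero, when \<open>a = b = 0\<close>. This is the two-point core of the four functions
  theorem.\<close>

lemma add_le_add_of_mult_le_ennreal:
  fixes a b c d :: ennreal
  assumes "a \<le> c" "b \<le> c" "a * b \<le> c * d"
  shows "a + b \<le> c + d"
proof (cases "c = \<top> \<or> d = \<top>")
  case True
  then show ?thesis by auto
next
  case False
  then have "a \<noteq> \<top>" "b \<noteq> \<top>" using assms top.extremum_unique by blast+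
  with False obtain a' b' c' d' where eq: "a = ennreal a'" "b = ennreal b'" "c = ennreal c'"
      "d = ennreal d'" and nn: "0 \<le> a'" "0 \<le> b'" "0 \<le> c'" "0 \<le> d'"
    by (metis ennreal_cases)
  have le: "a' \<le> c'" "b' \<le> c'" "a' * b' \<le> c' * d'"
    using assms nn unfolding eq by (auto simp: ennreal_mult[symmetric])
  have "a' + b' \<le> c' + d'"
  proof (cases "c' = 0")
    case True
    then show ?thesis using le nn by simp
  next
    case False
    have "0 \<le> (c' - a') * (c' - b')" using le by simp
    then have "c' * (a' + b') \<le> c' * (c' + d')" using le(3) by (simp add: algebra_simps)
    then show ?thesis using False nn by simp
  qed
  then show ?thesis unfolding eq using nn by (simp add: ennreal_plus[symmetric] del: ennreal_plus)
qed

text \<open>Twice each product of integrals is the double integral of a symmetrised kernel such as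
  \<open>f1 x * f2 y + f2 x * f1 y\<close>. The two kernels compare pointwise, although their
  individual terms need not.\<close>

lemma four_functions_linorder:
  fixes f1 f2 f3 f4 :: "'a::linorder \<Rightarrow> ennreal"
  assumes [measurable]: "f1 \<in> borel_measurable N" "f2 \<in> borel_measurable N"
      "f3 \<in> borel_measurable N" "f4 \<in> borel_measurable N"
    and le: "\<And>x y. x \<in> space N \<Longrightarrow> y \<in> space N \<Longrightarrow> f1 x * f2 y \<le> f3 (max x y) * f4 (min x y)"
  shows "(\<integral>\<^sup>+x. f1 x \<partial>N) * (\<integral>\<^sup>+x. f2 x \<partial>N) \<le> (\<integral>\<^sup>+x. f3 x \<partial>N) * (\<integral>\<^sup>+x. f4 x \<partial>N)"
proof -
  have ordered: "f1 x * f2 y + f1 y * f2 x \<le> f3 x * f4 y + f3 y * f4 x"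
    if "x \<le> y" "x \<in> space N" "y \<in> space N" for x y
  proof -
    \<comment> \<open>The product \<open>f3 y * f4 x\<close>, with the larger point in
      \<open>f3\<close>, plays the role of \<open>c\<close>: it dominates both cross terms, and the
      diagonal cases of the hypothesis at \<open>x\<close> and at \<open>y\<close> supply the
      product bound.\<close>
    have "f1 x * f2 y + f1 y * f2 x \<le> f3 y * f4 x + f3 x * f4 y"
    proof (rule add_le_add_of_mult_le_ennreal)
      show "f1 x * f2 y \<le> f3 y * f4 x" using le[of x y] that by (simp add: max_def min_def)
      show "f1 y * f2 x \<le> f3 y * f4 x" using le[of y x] that by (auto simp: max_def min_def split: if_splits)
      have "(f1 x * f2 x) * (f1 y * f2 y) \<le> (f3 x * f4 x) * (f3 y * f4 y)"
        using le[of x x] le[of y y] that by (intro mult_mono[of "f1 x * f2 x"]) auto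
      then show "f1 x * f2 y * (f1 y * f2 x) \<le> f3 y * f4 x * (f3 x * f4 y)"
        by (simp add: mult_ac)
    qed
    then show ?thesis by (simp add: add.commute)
  qed
  have sym: "f1 x * f2 y + f2 x * f1 y \<le> f3 x * f4 y + f4 x * f3 y"
    if "x \<in> space N" "y \<in> space N" for x y
    using ordered[of x y] ordered[of y x] that by (cases "x \<le> y") (auto simp: ac_simps)
  have double: "(\<integral>\<^sup>+x. (\<integral>\<^sup>+y. g x * h y + h x * g y \<partial>N) \<partial>N) = 2 * ((\<integral>\<^sup>+x. g x \<partial>N) * (\<integral>\<^sup>+x. h x \<partial>N))"
    if [measurable]: "g \<in> borel_measurable N" "h \<in> borel_measurable N" for g h :: "'a \<Rightarrow> ennreal"
    by (simp add: nn_integral_add nn_integral_cmult nn_integral_multc mult_2 mult.commute)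
  have "(\<integral>\<^sup>+x. (\<integral>\<^sup>+y. f1 x * f2 y + f2 x * f1 y \<partial>N) \<partial>N) \<le> (\<integral>\<^sup>+x. (\<integral>\<^sup>+y. f3 x * f4 y + f4 x * f3 y \<partial>N) \<partial>N)"
    by (intro nn_integral_mono sym)
  then show ?thesis
    by (simp add: double ennreal_mult_le_mult_iff)
qed

text \<open>Integrate out one coordinate: the one-dimensional case, applied to the slices through
  \<open>x\<close>, \<open>y\<close> and their coordinatewise maximum and minimum, shows that the
  four marginals satisfy the same hypothesis on the remaining coordinates.\<close>

lemma four_functions_PiM:
  fixes M :: "'i \<Rightarrow> 'a::linorder measure" and f1 f2 f3 f4 :: "('i \<Rightarrow> 'a) \<Rightarrow> ennreal"
  assumes M: "product_sigma_finite M" and "finite I"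
    and "f1 \<in> borel_measurable (Pi\<^sub>M I M)" "f2 \<in> borel_measurable (Pi\<^sub>M I M)"
      "f3 \<in> borel_measurable (Pi\<^sub>M I M)" "f4 \<in> borel_measurable (Pi\<^sub>M I M)"
    and "\<And>x y. x \<in> space (Pi\<^sub>M I M) \<Longrightarrow> y \<in> space (Pi\<^sub>M I M) \<Longrightarrow>
      f1 x * f2 y \<le> f3 (\<lambda>i\<in>I. max (x i) (y i)) * f4 (\<lambda>i\<in>I. min (x i) (y i))"
  shows "(\<integral>\<^sup>+x. f1 x \<partial>Pi\<^sub>M I M) * (\<integral>\<^sup>+x. f2 x \<partial>Pi\<^sub>M I M)
    \<le> (\<integral>\<^sup>+x. f3 x \<partial>Pi\<^sub>M I M) * (\<integral>\<^sup>+x. f4 x \<partial>Pi\<^sub>M I M)"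
  using assms(2-)
proof (induction I arbitrary: f1 f2 f3 f4 rule: finite_induct)
  case empty
  interpret product_sigma_finite M by (rule M)
  from empty(5)[of "\<lambda>_. undefined" "\<lambda>_. undefined"] show ?case
    by (simp add: nn_integral_empty space_PiM_empty restrict_def)
next
  case (insert i I)
  interpret product_sigma_finite M by (rule M)
  have slice: "(\<lambda>y. f (x(i := y))) \<in> borel_measurable (M i)"
    if "f \<in> borel_measurable (Pi\<^sub>M (insert i I) M)" "x \<in> space (Pi\<^sub>M I M)"
    for f :: "_ \<Rightarrow> ennreal" and x
    using measurable_compose[OF measurable_component_update[OF that(2) insert.hyps(2)] that(1)] .
  have marginal: "(\<lambda>x. \<integral>\<^sup>+y. f (x(i := y)) \<partial>M i) \<in> borel_measurable (Pi\<^sub>M I M)"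
    if "f \<in> borel_measurable (Pi\<^sub>M (insert i I) M)" for f :: "_ \<Rightarrow> ennreal"
  proof -
    interpret Mi: sigma_finite_measure "M i" by (rule sigma_finite_measures)
    have [measurable]: "(\<lambda>(x, y). f (x(i := y))) \<in> borel_measurable (Pi\<^sub>M I M \<Otimes>\<^sub>M M i)"
      using measurable_compose[OF measurable_add_dim that] by (simp add: case_prod_beta')
    show ?thesis by measurable
  qed
  have upd: "(\<lambda>j\<in>insert i I. g ((x(i := s)) j) ((y(i := t)) j)) = (\<lambda>j\<in>I. g (x j) (y j))(i := g s t)"
    for g :: "'a \<Rightarrow> 'a \<Rightarrow> 'a" and x y s t
    using insert.hyps(2) by (auto simp: fun_eq_iff restrict_def)
  show ?case
    unfolding product_nn_integral_insert[OF insert.hyps(1,2) insert.prems(1)]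
      product_nn_integral_insert[OF insert.hyps(1,2) insert.prems(2)]
      product_nn_integral_insert[OF insert.hyps(1,2) insert.prems(3)]
      product_nn_integral_insert[OF insert.hyps(1,2) insert.prems(4)]
  proof (rule insert.IH)
    fix x y assume x: "x \<in> space (Pi\<^sub>M I M)" and y: "y \<in> space (Pi\<^sub>M I M)"
    have lattice: "(\<lambda>j\<in>I. max (x j) (y j)) \<in> space (Pi\<^sub>M I M)" "(\<lambda>j\<in>I. min (x j) (y j)) \<in> space (Pi\<^sub>M I M)"
      using x y by (auto simp: space_PiM PiE_iff max_def min_def)
    show "(\<integral>\<^sup>+s. f1 (x(i := s)) \<partial>M i) * (\<integral>\<^sup>+s. f2 (y(i := s)) \<partial>M i)
      \<le> (\<integral>\<^sup>+s. f3 ((\<lambda>j\<in>I. max (x j) (y j))(i := s)) \<partial>M i)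
        * (\<integral>\<^sup>+s. f4 ((\<lambda>j\<in>I. min (x j) (y j))(i := s)) \<partial>M i)"
    proof (rule four_functions_linorder)
      fix s t assume st: "s \<in> space (M i)" "t \<in> space (M i)"
      have "x(i := s) \<in> space (Pi\<^sub>M (insert i I) M)" "y(i := t) \<in> space (Pi\<^sub>M (insert i I) M)"
        using x y st by (auto simp: space_PiM PiE_iff extensional_def)
      from insert.prems(5)[OF this]
      show "f1 (x(i := s)) * f2 (y(i := t)) \<le> f3 ((\<lambda>j\<in>I. max (x j) (y j))(i := max s t))
        * f4 ((\<lambda>j\<in>I. min (x j) (y j))(i := min s t))"
        by (simp only: upd)
    qed (intro slice insert.prems x y lattice)+
  qed (intro marginal insert.prems)+
qed

section \<open>From product measures to MTP2 random vectors\<close>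

text \<open>Four functions theorem for the density times the indicators of \<open>A\<close>,
  \<open>B\<close>, \<open>C\<close> and \<open>D\<close>: MTP2 handles the density, the lattice
  condition the indicators.\<close>

lemma (in finite_measure) MTP2_vector_lattice_inequality:
  fixes X :: "'i \<Rightarrow> 'a \<Rightarrow> real"
  assumes mtp2: "MTP2_vector M I X" and I: "finite I"
    and sets: "A \<in> sets (Pi\<^sub>M I (\<lambda>_. borel))" "B \<in> sets (Pi\<^sub>M I (\<lambda>_. borel))"
      "C \<in> sets (Pi\<^sub>M I (\<lambda>_. borel))" "D \<in> sets (Pi\<^sub>M I (\<lambda>_. borel))"
    and lattice: "\<And>x y. x \<in> A \<Longrightarrow> y \<in> B \<Longrightarrow>
      (\<lambda>i\<in>I. max (x i) (y i)) \<in> C \<and> (\<lambda>i\<in>I. min (x i) (y i)) \<in> D"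
  shows "measure M {\<omega>\<in>space M. (\<lambda>i\<in>I. X i \<omega>) \<in> A} * measure M {\<omega>\<in>space M. (\<lambda>i\<in>I. X i \<omega>) \<in> B}
    \<le> measure M {\<omega>\<in>space M. (\<lambda>i\<in>I. X i \<omega>) \<in> C} * measure M {\<omega>\<in>space M. (\<lambda>i\<in>I. X i \<omega>) \<in> D}"
proof -
  obtain N' f where N': "\<And>i. i \<in> I \<Longrightarrow> sigma_finite_measure (N' i)"
      "\<And>i. i \<in> I \<Longrightarrow> sets (N' i) = sets borel"
    and f: "MTP2_on I f"
    and dist': "distributed M (Pi\<^sub>M I N') (\<lambda>\<omega>. \<lambda>i\<in>I. X i \<omega>) (\<lambda>x. ennreal (f x))"
    using mtp2 unfolding MTP2_vector_def by blast
  \<comment> \<open>\<open>product_sigma_finite\<close> speaks of every index, while the given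
    measures are controlled only on \<open>I\<close>; \<open>lborel\<close> is a default
    elsewhere.\<close>
  define N where "N i = (if i \<in> I then N' i else lborel)" for i
  have "Pi\<^sub>M I N' = Pi\<^sub>M I N" by (intro PiM_cong) (auto simp: N_def)
  with dist' have dist: "distributed M (Pi\<^sub>M I N) (\<lambda>\<omega>. \<lambda>i\<in>I. X i \<omega>) (\<lambda>x. ennreal (f x))"
    by simp
  have N: "product_sigma_finite N"
    unfolding product_sigma_finite_def using N'(1)
    by (simp add: N_def lborel.sigma_finite_measure_axioms)
  have sets_N: "sets (Pi\<^sub>M I N) = sets (Pi\<^sub>M I (\<lambda>_. borel))"
    by (intro sets_PiM_cong) (auto simp: N_def N')
  then have space_N: "space (Pi\<^sub>M I N) = (\<Pi>\<^sub>E i\<in>I. UNIV)"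
    using sets_eq_imp_space_eq[OF sets_N] by (simp add: space_PiM)
  note sets_N' = sets[folded sets_N]
  have [measurable]: "(\<lambda>x. ennreal (f x)) \<in> borel_measurable (Pi\<^sub>M I N)"
    using dist by (rule distributed_borel_measurable)
  have law: "ennreal (measure M {\<omega>\<in>space M. (\<lambda>i\<in>I. X i \<omega>) \<in> S})
      = (\<integral>\<^sup>+x. ennreal (f x) * indicator S x \<partial>Pi\<^sub>M I N)" if "S \<in> sets (Pi\<^sub>M I N)" for S
  proof -
    have "{\<omega>\<in>space M. (\<lambda>i\<in>I. X i \<omega>) \<in> S} = (\<lambda>\<omega>. \<lambda>i\<in>I. X i \<omega>) -` S \<inter> space M" by auto
    then show ?thesis
      using distributed_emeasure[OF dist that] by (simp add: emeasure_eq_measure)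
  qed
  have "ennreal (measure M {\<omega>\<in>space M. (\<lambda>i\<in>I. X i \<omega>) \<in> A})
        * ennreal (measure M {\<omega>\<in>space M. (\<lambda>i\<in>I. X i \<omega>) \<in> B})
      \<le> ennreal (measure M {\<omega>\<in>space M. (\<lambda>i\<in>I. X i \<omega>) \<in> C})
        * ennreal (measure M {\<omega>\<in>space M. (\<lambda>i\<in>I. X i \<omega>) \<in> D})"
    unfolding law[OF sets_N'(1)] law[OF sets_N'(2)] law[OF sets_N'(3)] law[OF sets_N'(4)]
  proof (rule four_functions_PiM[OF N I])
    fix x y assume "x \<in> space (Pi\<^sub>M I N)" "y \<in> space (Pi\<^sub>M I N)"
    then have xy: "x \<in> (\<Pi>\<^sub>E i\<in>I. UNIV)" "y \<in> (\<Pi>\<^sub>E i\<in>I. UNIV)" by (simp_all only: space_N)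
    have nonneg: "0 \<le> f z" if "z \<in> (\<Pi>\<^sub>E i\<in>I. UNIV)" for z
      using f that unfolding MTP2_on_def by blast
    have "f x * f y \<le> f (\<lambda>i\<in>I. max (x i) (y i)) * f (\<lambda>i\<in>I. min (x i) (y i))"
      using f xy unfolding MTP2_on_def by blast
    then have "ennreal (f x) * ennreal (f y)
        \<le> ennreal (f (\<lambda>i\<in>I. max (x i) (y i))) * ennreal (f (\<lambda>i\<in>I. min (x i) (y i)))"
      by (subst (1 2) ennreal_mult[symmetric]) (auto intro!: nonneg xy ennreal_leI)
    then show "ennreal (f x) * indicator A x * (ennreal (f y) * indicator B y)
      \<le> ennreal (f (\<lambda>i\<in>I. max (x i) (y i))) * indicator C (\<lambda>i\<in>I. max (x i) (y i))
        * (ennreal (f (\<lambda>i\<in>I. min (x i) (y i))) * indicator D (\<lambda>i\<in>I. min (x i) (y i)))"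
      using lattice[of x y] by (auto simp: indicator_def)
  qed (use sets_N' in measurable)
  then show ?thesis by (simp add: ennreal_mult[symmetric])
qed

subsection \<open>A generalized Simes inequality\<close>

text \<open>Bounds \<open>\<alpha> / ((m + k - j) choose k)\<close> by
  \<open>\<alpha> * (j choose k) / (m choose k)\<close>, the form the Simes-type inequality
  requires. The induction on \<open>k\<close> rests on absorption,
  \<open>Suc k * (Suc m choose Suc k) = Suc m * (m choose k)\<close>.\<close>

lemma binomial_le_mult_binomial:
  fixes j k m :: nat
  assumes "k \<le> j" "j \<le> m"
  shows "m choose k \<le> (j choose k) * ((m + k - j) choose k)"
  using assms
proof (induction k arbitrary: j m)
  case 0
  then show ?case by simp
next
  case (Suc k)
  then obtain j' m' where jm: "j = Suc j'" "m = Suc m'" by (metis Suc_le_D)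
  have "m' choose k \<le> (j' choose k) * ((m' + k - j') choose k)"
    using Suc jm by auto
  define l where "l = m' + k - j'"
  \<comment> \<open>Writing \<open>j' = k + p\<close> and \<open>m' = j' + q\<close> gives
    \<open>l = k + q\<close>, and the two sides differ by exactly \<open>p * q\<close>.\<close>
  have "Suc k * Suc m' \<le> Suc j' * Suc l"
  proof -
    obtain p q where "j' = k + p" "m' = j' + q" using Suc.prems jm by (metis Suc_le_mono le_Suc_ex)
    then show ?thesis by (simp add: l_def algebra_simps)
  qed
  moreover have "m' choose k \<le> (j' choose k) * (l choose k)"
    using Suc jm by (auto simp: l_def)
  ultimately have "(Suc k * Suc m') * (m' choose k) \<le> (Suc j' * Suc l) * ((j' choose k) * (l choose k))"
    by (rule mult_le_mono)
  then have "Suc k * (Suc m' * (m' choose k)) \<le> (Suc j' * (j' choose k)) * (Suc l * (l choose k))"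
    by (simp only: mult_ac)
  then have "Suc k * (Suc k * (Suc m' choose Suc k)) \<le> (Suc k * (Suc j' choose Suc k)) * (Suc k * (Suc l choose Suc k))"
    by (simp only: Suc_times_binomial_eq mult.commute[of "_ choose Suc k"])
  then have "(Suc k * Suc k) * (Suc m' choose Suc k) \<le> (Suc k * Suc k) * ((Suc j' choose Suc k) * (Suc l choose Suc k))"
    by (simp only: mult_ac)
  then have "Suc m' choose Suc k \<le> (Suc j' choose Suc k) * (Suc l choose Suc k)"
    by (subst (asm) mult_le_cancel1) simp
  moreover have "m + Suc k - j = Suc l" using Suc.prems jm by (simp add: l_def)
  ultimately show ?case by (simp add: jm)
qed

text \<open>Double counting: the sum is the integral over \<open>S\<close> of the number of sets
  \<open>A J\<close> containing the point, which is \<open>c\<close> throughout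
  \<open>S\<close>.\<close>

lemma (in finite_measure) measure_multiple_cover:
  assumes fin: "finite \<J>" and S: "S \<in> sets M" and A: "\<And>J. J \<in> \<J> \<Longrightarrow> A J \<in> sets M"
    and count: "\<And>\<omega>. \<omega> \<in> S \<Longrightarrow> card {J\<in>\<J>. \<omega> \<in> A J} = c"
  shows "(\<Sum>J\<in>\<J>. measure M (S \<inter> A J)) = real c * measure M S"
proof -
  have "(\<Sum>J\<in>\<J>. measure M (S \<inter> A J)) = (\<Sum>J\<in>\<J>. \<integral>\<omega>. indicator (S \<inter> A J) \<omega> \<partial>M)"
    using S A by (intro sum.cong) (auto simp: sets.Int_space_eq2)
  also have "\<dots> = (\<integral>\<omega>. (\<Sum>J\<in>\<J>. indicator (S \<inter> A J) \<omega>) \<partial>M)"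
    using S A by (intro Bochner_Integration.integral_sum[symmetric]) (auto intro!: integrable_real_indicator
        simp: less_top[symmetric])
  also have "\<dots> = (\<integral>\<omega>. real c * indicator S \<omega> \<partial>M)"
  proof (intro Bochner_Integration.integral_cong refl)
    fix \<omega>
    have "(\<Sum>J\<in>\<J>. indicator (S \<inter> A J) \<omega>) = indicator S \<omega> * (\<Sum>J\<in>\<J>. indicator (A J) \<omega> :: real)"
      by (simp add: indicator_inter_arith sum_distrib_left)
    also have "(\<Sum>J\<in>\<J>. indicator (A J) \<omega> :: real) = real (card {J\<in>\<J>. \<omega> \<in> A J})"
      using fin by (simp add: indicator_def sum.If_cases Int_def)
    finally show "(\<Sum>J\<in>\<J>. indicator (S \<inter> A J) \<omega>) = real c * indicator S \<omega>"
      by (auto simp: indicator_def count split: if_splits)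
  qed
  also have "\<dots> = real c * measure M S" using S by (simp add: sets.Int_space_eq2)
  finally show ?thesis .
qed

text \<open>With \<open>e j = Pr(R \<ge> j, P\<^sub>J \<le> \<beta>\<^sub>j)\<close>, \<open>h j = Pr(R > j, P\<^sub>J \<le> \<beta>\<^sub>j)\<close> and \<open>g j = G(\<beta>\<^sub>j)\<close>, the last
  assumption is the monotonicity of \<open>Pr(R > j | P\<^sub>J \<le> u)\<close> in \<open>u\<close>.\<close>

lemma sum_conditional_telescope_le:
  fixes e h g w :: "nat \<Rightarrow> real" and c :: real
  assumes "k \<le> m" and g: "\<And>j. j \<in> {k..m} \<Longrightarrow> 0 < g j"
    and w: "\<And>j. j \<in> {k..m} \<Longrightarrow> w j * g j \<le> c"
    and h: "\<And>j. j \<in> {k..m} \<Longrightarrow> h j \<le> e j" and hm: "0 \<le> h m"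
    and ek: "e k \<le> g k" and c: "0 \<le> c"
    and mono: "\<And>j. j \<in> {k..<m} \<Longrightarrow> e (Suc j) * g j \<le> h j * g (Suc j)"
  shows "(\<Sum>j=k..m. w j * (e j - h j)) \<le> c"
proof -
  have term_le: "w j * (e j - h j) \<le> c * (e j / g j - h j / g j)" if "j \<in> {k..m}" for j
  proof -
    have "w j * (e j - h j) = (w j * g j) * ((e j - h j) / g j)" using g[OF that] by simp
    also have "\<dots> \<le> c * ((e j - h j) / g j)"
      using w[OF that] h[OF that] g[OF that] by (intro mult_right_mono) auto
    finally show ?thesis by (simp add: diff_divide_distrib)
  qed
  have ratio: "e (Suc j) / g (Suc j) \<le> h j / g j" if "j \<in> {k..<m}" for j
    using mono[OF that] g[of j] g[of "Suc j"] that by (simp add: divide_simps mult_ac)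
  \<comment> \<open>The subtracted \<open>h l / g l\<close> must be kept: by \<open>ratio\<close> it
    absorbs the next positive term \<open>e (Suc l) / g (Suc l)\<close>.\<close>
  have partial: "(\<Sum>j=k..l. w j * (e j - h j)) \<le> c * (e k / g k - h l / g l)"
    if "k \<le> l" "l \<le> m" for l
    using that
  proof (induction l rule: dec_induct)
    case base
    then show ?case using term_le[of k] by simp
  next
    case (step l)
    have "(\<Sum>j=k..Suc l. w j * (e j - h j))
        \<le> c * (e k / g k - h l / g l) + c * (e (Suc l) / g (Suc l) - h (Suc l) / g (Suc l))"
      using step term_le[of "Suc l"] by simp
    also have "\<dots> \<le> c * (e k / g k - h (Suc l) / g (Suc l))"
      using mult_left_mono[OF ratio[of l] c] step by (simp add: algebra_simps)
    finally show ?case .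
  qed
  have "0 \<le> h m / g m" "e k / g k \<le> 1" using g[of m] g[of k] hm ek \<open>k \<le> m\<close> by simp_all
  then have "c * (e k / g k - h m / g m) \<le> c * 1" using c by (intro mult_left_mono) auto
  then show ?thesis using partial[of m] \<open>k \<le> m\<close> by simp
qed

section \<open>The stepup count as a monotone statistic\<close>

text \<open>Encodes \<open>R \<ge> j\<close>. The existential form avoids a maximum over a possibly
  empty set and makes the events visibly nested in \<open>j\<close>.\<close>

definition stepup_ge :: "'i set \<Rightarrow> (nat \<Rightarrow> real) \<Rightarrow> nat \<Rightarrow> ('i \<Rightarrow> real) \<Rightarrow> bool" where
  "stepup_ge I \<beta> j x \<longleftrightarrow> (\<exists>l\<in>{j..card I}. l \<le> card {i\<in>I. x i \<le> \<beta> l})"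

text \<open>Lowering coordinates only enlarges each count, so the same witness \<open>l\<close>
  works. The event is thus a down-set, preserved by coordinatewise minima.\<close>

lemma stepup_ge_antimono:
  assumes "finite I" "stepup_ge I \<beta> j y" "\<And>i. i \<in> I \<Longrightarrow> x i \<le> y i"
  shows "stepup_ge I \<beta> j x"
proof -
  obtain l where l: "l \<in> {j..card I}" "l \<le> card {i\<in>I. y i \<le> \<beta> l}"
    using assms(2) unfolding stepup_ge_def by blast
  have "card {i\<in>I. y i \<le> \<beta> l} \<le> card {i\<in>I. x i \<le> \<beta> l}"
    using assms(1,3) by (intro card_mono) (auto intro: order_trans)
  with l show ?thesis unfolding stepup_ge_def by (blast intro: order_trans)
qed

lemma stepup_ge_cong: "(\<And>i. i \<in> I \<Longrightarrow> x i = y i) \<Longrightarrow> stepup_ge I \<beta> j x = stepup_ge I \<beta> j y"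
  by (simp add: stepup_ge_def cong: conj_cong)

text \<open>The hypotheses say \<open>R = j\<close>. More than \<open>j\<close> coordinates below
  \<open>\<beta> j\<close> would put at least \<open>Suc j\<close> of them below
  \<open>\<beta> (Suc j)\<close>, forcing \<open>R \<ge> Suc j\<close>.\<close>

lemma card_eq_if_stepup_eq:
  assumes "finite I" and mono: "mono_on {k..card I} \<beta>" and "k \<le> j"
    and ge: "stepup_ge I \<beta> j x" and less: "\<not> stepup_ge I \<beta> (Suc j) x"
  shows "card {i\<in>I. x i \<le> \<beta> j} = j"
proof (rule antisym)
  obtain l where l: "l \<in> {j..card I}" "l \<le> card {i\<in>I. x i \<le> \<beta> l}"
    using ge unfolding stepup_ge_def by blast
  with less have "l = j" unfolding stepup_ge_def by (metis atLeastAtMost_iff le_antisym not_less_eq_eq)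
  with l show "j \<le> card {i\<in>I. x i \<le> \<beta> j}" by simp
  show "card {i\<in>I. x i \<le> \<beta> j} \<le> j"
  proof (rule ccontr)
    assume "\<not> card {i\<in>I. x i \<le> \<beta> j} \<le> j"
    then have big: "Suc j \<le> card {i\<in>I. x i \<le> \<beta> j}" by simp
    then have "Suc j \<le> card I"
      using card_mono[OF \<open>finite I\<close>, of "{i\<in>I. x i \<le> \<beta> j}"] by auto
    then have "\<beta> j \<le> \<beta> (Suc j)" using \<open>k \<le> j\<close> by (intro mono_onD[OF mono]) auto
    then have "card {i\<in>I. x i \<le> \<beta> j} \<le> card {i\<in>I. x i \<le> \<beta> (Suc j)}"
      using \<open>finite I\<close> by (intro card_mono) auto
    with big have "Suc j \<le> card {i\<in>I. x i \<le> \<beta> (Suc j)}" by (rule order_trans)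
    with \<open>Suc j \<le> card I\<close> less show False unfolding stepup_ge_def by auto
  qed
qed

lemma measurable_stepup_ge [measurable]:
  assumes "finite I" and [measurable]: "\<And>i. i \<in> I \<Longrightarrow> (\<lambda>\<omega>. X \<omega> i) \<in> borel_measurable M"
  shows "Measurable.pred M (\<lambda>\<omega>. stepup_ge I \<beta> j (X \<omega>))"
proof -
  \<comment> \<open>Writing the count as a finite sum of real-valued measurable functions makes
    measurability automatic.\<close>
  have "stepup_ge I \<beta> j x \<longleftrightarrow> (\<exists>l\<in>{j..card I}. real l \<le> (\<Sum>i\<in>I. if x i \<le> \<beta> l then 1 else 0))" for x
    using \<open>finite I\<close> by (simp add: stepup_ge_def sum.If_cases Int_def)
  then show ?thesis by simp
qed

text \<open>For \<open>k = 1\<close>, uniform coordinates, \<open>0 < \<alpha> < 1\<close> and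
  \<open>\<beta> j = j * \<alpha> / card I\<close> this is the classical Simes inequality.\<close>

lemma (in prob_space) generalized_Simes:
  fixes X :: "'i \<Rightarrow> 'a \<Rightarrow> real" and \<beta> :: "nat \<Rightarrow> real" and G :: "real \<Rightarrow> real"
    and \<alpha> :: real
  assumes mtp2: "MTP2_vector M I X" and I: "finite I" and "k \<le> card I"
    and X [measurable]: "\<And>i. i \<in> I \<Longrightarrow> X i \<in> borel_measurable M"
    and G: "\<And>J u. J \<subseteq> I \<Longrightarrow> card J = k \<Longrightarrow> prob {\<omega>\<in>space M. \<forall>i\<in>J. X i \<omega> \<le> u} = G u"
    and mono: "mono_on {k..card I} \<beta>"
    and pos: "\<And>j. j \<in> {k..card I} \<Longrightarrow> 0 < G (\<beta> j)" and "0 \<le> \<alpha>"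
    and le: "\<And>j. j \<in> {k..card I} \<Longrightarrow> G (\<beta> j) \<le> \<alpha> * (j choose k) / (card I choose k)"
  shows "prob {\<omega>\<in>space M. stepup_ge I \<beta> k (\<lambda>i. X i \<omega>)} \<le> \<alpha>"
proof -
  define m where "m = card I"
  define \<J> where "\<J> = {J. J \<subseteq> I \<and> card J = k}"
  define E where "E j = {\<omega>\<in>space M. stepup_ge I \<beta> j (\<lambda>i. X i \<omega>)}" for j
  define A where "A J u = {\<omega>\<in>space M. \<forall>i\<in>J. X i \<omega> \<le> u}" for J u
  have \<J>: "finite \<J>" "card \<J> = m choose k"
    using I by (auto simp: \<J>_def m_def n_subsets)
  have finJ: "finite J" "J \<subseteq> I" if "J \<in> \<J>" for J
    using that I by (auto simp: \<J>_def intro: finite_subset)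
  have E_sets [measurable]: "E j \<in> sets M" for j
    unfolding E_def using I by measurable
  have A_sets [measurable]: "A J u \<in> sets M" if "J \<in> \<J>" for J u
  proof -
    have [measurable]: "countable J" "\<And>i. i \<in> J \<Longrightarrow> X i \<in> borel_measurable M"
      using finJ[OF that] by (auto intro: countable_finite)
    show ?thesis unfolding A_def by measurable
  qed
  have E_Suc: "E (Suc j) \<subseteq> E j" for j
  proof -
    have "{Suc j..card I} \<subseteq> {j..card I}" by simp
    then show ?thesis unfolding E_def stepup_ge_def by blast
  qed
  have E_last: "E (Suc m) = {}" unfolding E_def stepup_ge_def m_def by auto
  have A_prob: "prob (A J u) = G u" if "J \<in> \<J>" for J u
    using G that unfolding A_def \<J>_def by blast
  \<comment> \<open>The probability of \<open>E j\<close> conditional on \<open>A J u\<close> is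
    nonincreasing in \<open>u\<close>, stated in cross-multiplied form.\<close>
  have FKG: "prob (E j \<inter> A J v) * prob (A J u) \<le> prob (E j \<inter> A J u) * prob (A J v)"
    if J: "J \<in> \<J>" and uv: "u \<le> v" for J j u v
  proof -
    define Q where "Q = {x \<in> space (Pi\<^sub>M I (\<lambda>_. borel)). stepup_ge I \<beta> j x}"
    define B where "B u = {x \<in> space (Pi\<^sub>M I (\<lambda>_. borel)). \<forall>i\<in>J. x i \<le> u}" for u :: real
    have J': "countable J" "J \<subseteq> I" using finJ[OF J] by (auto intro: countable_finite)
    have [measurable]: "Q \<in> sets (Pi\<^sub>M I (\<lambda>_. borel))"
      unfolding Q_def using I by measurable
    have [measurable]: "B u \<in> sets (Pi\<^sub>M I (\<lambda>_. borel))" for u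
    proof -
      have [measurable]: "(\<lambda>x. x i) \<in> borel_measurable (Pi\<^sub>M I (\<lambda>_. borel))" if "i \<in> J" for i
        using J' that by (intro measurable_component_singleton) auto
      show ?thesis unfolding B_def using J'(1) by measurable
    qed
    have X_Q: "(\<lambda>i\<in>I. X i \<omega>) \<in> Q \<longleftrightarrow> stepup_ge I \<beta> j (\<lambda>i. X i \<omega>)" for \<omega>
      using stepup_ge_cong[of I "\<lambda>i\<in>I. X i \<omega>" "\<lambda>i. X i \<omega>"] by (auto simp: Q_def space_PiM)
    have X_B: "(\<lambda>i\<in>I. X i \<omega>) \<in> B w \<longleftrightarrow> (\<forall>i\<in>J. X i \<omega> \<le> w)" for \<omega> w
      using J' by (auto simp: B_def space_PiM)
    \<comment> \<open>\<open>Q\<close> is paired with the larger threshold \<open>v\<close>: on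
      \<open>J\<close> the maximum stays below \<open>v\<close>, while the minimum gets the bound
      \<open>u\<close> from \<open>x\<close> and membership in the down-set \<open>Q\<close> from
      \<open>y\<close>.\<close>
    have "measure M {\<omega>\<in>space M. (\<lambda>i\<in>I. X i \<omega>) \<in> B u} * measure M {\<omega>\<in>space M. (\<lambda>i\<in>I. X i \<omega>) \<in> Q \<inter> B v}
      \<le> measure M {\<omega>\<in>space M. (\<lambda>i\<in>I. X i \<omega>) \<in> B v} * measure M {\<omega>\<in>space M. (\<lambda>i\<in>I. X i \<omega>) \<in> Q \<inter> B u}"
    proof (rule MTP2_vector_lattice_inequality[OF mtp2 I])
      fix x y assume x: "x \<in> B u" and y: "y \<in> Q \<inter> B v"
      have "stepup_ge I \<beta> j (\<lambda>i\<in>I. min (x i) (y i))"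
        using y by (auto simp: Q_def intro: stepup_ge_antimono[OF I, of \<beta> j y])
      moreover have "x i \<le> u" "x i \<le> v" "y i \<le> v" "i \<in> I" if "i \<in> J" for i
        using x y J' uv that unfolding B_def by force+
      ultimately show "(\<lambda>i\<in>I. max (x i) (y i)) \<in> B v \<and> (\<lambda>i\<in>I. min (x i) (y i)) \<in> Q \<inter> B u"
        by (simp add: B_def Q_def space_PiM min_le_iff_disj)
    qed measurable
    moreover have "{\<omega>\<in>space M. (\<lambda>i\<in>I. X i \<omega>) \<in> B w} = A J w"
      "{\<omega>\<in>space M. (\<lambda>i\<in>I. X i \<omega>) \<in> Q \<inter> B w} = E j \<inter> A J w" for w
      by (auto simp: X_Q X_B A_def E_def)
    ultimately show ?thesis by (simp add: mult.commute)
  qed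
  have cover: "prob (E j - E (Suc j))
      = (\<Sum>J\<in>\<J>. 1 / (j choose k) * (prob (E j \<inter> A J (\<beta> j)) - prob (E (Suc j) \<inter> A J (\<beta> j))))"
    if j: "j \<in> {k..m}" for j
  proof -
    have "(\<Sum>J\<in>\<J>. prob ((E j - E (Suc j)) \<inter> A J (\<beta> j))) = real (j choose k) * prob (E j - E (Suc j))"
    proof (rule measure_multiple_cover)
      fix \<omega> assume \<omega>: "\<omega> \<in> E j - E (Suc j)"
      then have "card {i\<in>I. X i \<omega> \<le> \<beta> j} = j"
        using card_eq_if_stepup_eq[OF I mono, of j "\<lambda>i. X i \<omega>"] j by (auto simp: E_def)
      \<comment> \<open>The subsets counted are the \<open>k\<close>-subsets of a set with exactly
        \<open>j\<close> elements.\<close>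
      moreover have "{J\<in>\<J>. \<omega> \<in> A J (\<beta> j)} = {J. J \<subseteq> {i\<in>I. X i \<omega> \<le> \<beta> j} \<and> card J = k}"
        using \<omega> by (auto simp: \<J>_def A_def E_def)
      ultimately show "card {J\<in>\<J>. \<omega> \<in> A J (\<beta> j)} = j choose k"
        using I by (simp add: n_subsets)
    qed (auto simp: \<J>)
    moreover have "prob ((E j - E (Suc j)) \<inter> A J (\<beta> j))
        = prob (E j \<inter> A J (\<beta> j)) - prob (E (Suc j) \<inter> A J (\<beta> j))" if "J \<in> \<J>" for J
    proof -
      have "(E j - E (Suc j)) \<inter> A J (\<beta> j) = E j \<inter> A J (\<beta> j) - E (Suc j) \<inter> A J (\<beta> j)" by blast
      then show ?thesis
        using E_Suc[of j] A_sets[OF that] by (auto intro!: finite_measure_Diff)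
    qed
    moreover have "0 < j choose k" using j by (simp add: zero_less_binomial)
    ultimately show ?thesis by (simp add: sum_divide_distrib[symmetric])
  qed
  have per_J: "(\<Sum>j=k..m. 1 / (j choose k) * (prob (E j \<inter> A J (\<beta> j)) - prob (E (Suc j) \<inter> A J (\<beta> j))))
      \<le> \<alpha> / (m choose k)" if J: "J \<in> \<J>" for J
  proof (rule sum_conditional_telescope_le[where g = "\<lambda>j. G (\<beta> j)"])
    fix j assume j: "j \<in> {k..m}"
    show "1 / (j choose k) * G (\<beta> j) \<le> \<alpha> / (m choose k)"
      using le[of j] j zero_less_binomial[of k j] unfolding m_def
      by (simp add: field_simps)
    show "prob (E (Suc j) \<inter> A J (\<beta> j)) \<le> prob (E j \<inter> A J (\<beta> j))"
      using E_Suc A_sets[OF J] by (intro finite_measure_mono) auto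
  next
    fix j assume "j \<in> {k..<m}"
    then have "\<beta> j \<le> \<beta> (Suc j)" by (intro mono_onD[OF mono]) (auto simp: m_def)
    \<comment> \<open>The event \<open>R > j\<close> is held fixed while the threshold rises from
      \<open>\<beta> j\<close> to \<open>\<beta> (Suc j)\<close>; this links consecutive terms of
      the telescoping sum.\<close>
    from FKG[OF J this, of "Suc j"]
    show "prob (E (Suc j) \<inter> A J (\<beta> (Suc j))) * G (\<beta> j) \<le> prob (E (Suc j) \<inter> A J (\<beta> j)) * G (\<beta> (Suc j))"
      by (simp add: A_prob[OF J])
  next
    show "prob (E k \<inter> A J (\<beta> k)) \<le> G (\<beta> k)"
      unfolding A_prob[OF J, symmetric] using A_sets[OF J] by (intro finite_measure_mono) auto
  qed (use pos \<open>k \<le> card I\<close> \<open>0 \<le> \<alpha>\<close> in \<open>auto simp: m_def\<close>)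
  have "prob (E k) = (\<Sum>j=k..m. prob (E j) - prob (E (Suc j)))"
    using sum_Suc_diff[of k m "\<lambda>j. - prob (E j)"] \<open>k \<le> card I\<close> E_last
    by (simp add: m_def)
  also have "\<dots> = (\<Sum>j=k..m. prob (E j - E (Suc j)))"
    using E_Suc by (intro sum.cong refl finite_measure_Diff[symmetric]) auto
  also have "\<dots> = (\<Sum>J\<in>\<J>. \<Sum>j=k..m. 1 / (j choose k) * (prob (E j \<inter> A J (\<beta> j)) - prob (E (Suc j) \<inter> A J (\<beta> j))))"
    by (subst sum.swap) (intro sum.cong refl cover)
  also have "\<dots> \<le> (\<Sum>J\<in>\<J>. \<alpha> / (m choose k))" by (intro sum_mono per_J)
  also have "\<dots> = \<alpha>" using \<J> \<open>k \<le> card I\<close> by (simp add: m_def)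
  finally show ?thesis by (simp add: E_def)
qed

subsection \<open>The generalized stepup procedure\<close>

lemma bij_betw_ord_index: "bij_betw (ord_index n p) {1..n} {1..n}"
proof -
  let ?xs = "sort_key p [1..<Suc n]"
  have "bij_betw ((!) ?xs) {..<n} {1..n}" by (intro bij_betw_nth) (auto simp del: upt_Suc)
  moreover have "bij_betw (\<lambda>j. j - 1) {1..n} {..<n}"
    by (rule bij_betw_byWitness[where f' = Suc]) auto
  ultimately have "bij_betw ((!) ?xs \<circ> (\<lambda>j. j - 1)) {1..n} {1..n}" by (rule bij_betw_trans[rotated])
  then show ?thesis by (simp add: ord_index_def[abs_def] comp_def)
qed

lemma ord_pvalue_mono:
  assumes "1 \<le> i" "i \<le> j" "j \<le> n"
  shows "ord_pvalue n p i \<le> ord_pvalue n p j"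
proof -
  let ?xs = "sort_key p [1..<Suc n]"
  have "map p ?xs ! (i - 1) \<le> map p ?xs ! (j - 1)"
    using assms by (intro sorted_nth_mono sorted_sort_key) auto
  then show ?thesis using assms by (simp add: ord_pvalue_def ord_index_def)
qed

text \<open>If \<open>r\<close> hypotheses are rejected, \<open>v\<close> of them in
  \<open>I\<close>, then at most \<open>n - card I\<close> lie outside \<open>I\<close>, so
  \<open>r \<le> n - card I + v\<close>. All rejected values are at most
  \<open>a r \<le> a (n - card I + v)\<close>, which makes \<open>v\<close> the required
  witness.\<close>

lemma gen_stepup_imp_stepup_ge:
  assumes "1 \<le> k" and I: "I \<subseteq> {1..n}" and mono: "mono_on {k..n} a"
    and rejected: "k \<le> card (gen_stepup k n a p \<inter> I)"
  shows "stepup_ge I (\<lambda>j. a (n - card I + j)) k p"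
proof -
  define S where "S = {j \<in> {1..n}. ord_pvalue n p j \<le> a (max j k)}"
  define r where "r = Max S"
  define R where "R = ord_index n p ` {i \<in> {1..n}. i \<le> r}"
  define v where "v = card (R \<inter> I)"
  have "gen_stepup k n a p \<noteq> {}" using rejected \<open>1 \<le> k\<close> by auto
  then have "S \<noteq> {}" and step: "gen_stepup k n a p = R"
    by (auto simp: gen_stepup_def Let_def S_def r_def R_def split: if_splits)
  then have "r \<in> S" unfolding r_def by (intro Max_in) (auto simp: S_def)
  then have r: "1 \<le> r" "r \<le> n" "ord_pvalue n p r \<le> a (max r k)" by (auto simp: S_def)
  have R_eq: "R = ord_index n p ` {1..r}"
    unfolding R_def using r by (intro arg_cong[where f = "image _"]) auto
  have inj: "inj_on (ord_index n p) {1..r}"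
    using bij_betw_imp_inj_on[OF bij_betw_ord_index[of n p]] r by (auto elim: inj_on_subset)
  have card_R: "card R = r" using card_image[OF inj] by (simp add: R_eq)
  have "R \<subseteq> {1..n}"
    using bij_betw_imp_surj_on[OF bij_betw_ord_index[of n p]] unfolding R_def by blast
  then have finR: "finite R" by (rule finite_subset) simp
  have finI: "finite I" using I by (rule finite_subset) simp
  have "card (R - I) \<le> card ({1..n} - I)" using \<open>R \<subseteq> {1..n}\<close> by (intro card_mono) auto
  also have "\<dots> = n - card I" using I finI by (simp add: card_Diff_subset)
  finally have "r \<le> n - card I + v"
    using card_R card_Diff_subset_Int[of R I] finR card_mono[of R "R \<inter> I"] by (simp add: v_def)
  moreover have "k \<le> v" using rejected step by (simp add: v_def)
  moreover have "v \<le> r" unfolding v_def card_R[symmetric] using finR by (intro card_mono) auto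
  moreover have "v \<le> card I" unfolding v_def using finI by (intro card_mono) auto
  moreover have "card I \<le> n" using card_mono[OF _ I] by simp
  ultimately have "a r \<le> a (n - card I + v)" and v: "v \<in> {k..card I}" and "k \<le> r"
    by (auto intro!: mono_onD[OF mono])
  have "p i \<le> a (n - card I + v)" if i: "i \<in> R" for i
  proof -
    obtain j where "j \<in> {1..r}" "i = ord_index n p j" using i unfolding R_eq by blast
    then have "p i \<le> ord_pvalue n p r" using ord_pvalue_mono[of j r n p] r by (simp add: ord_pvalue_def)
    \<comment> \<open>Since \<open>k \<le> v \<le> r\<close>, the critical value
      \<open>a (max r k)\<close> is simply \<open>a r\<close>.\<close>
    with r \<open>k \<le> r\<close> \<open>a r \<le> _\<close> show ?thesis by (simp add: max_absorb1)
  qed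
  then have "v \<le> card {i\<in>I. p i \<le> a (n - card I + v)}"
    unfolding v_def using finI by (intro card_mono) auto
  with v show ?thesis unfolding stepup_ge_def by blast
qed

theorem theorem4p2:
  fixes k n :: nat and \<alpha> :: real
    and \<Theta> :: "'t set" and M :: "'t \<Rightarrow> 'a measure"
    and H :: "nat \<Rightarrow> 't set" and P :: "nat \<Rightarrow> 'a \<Rightarrow> real"
    and G :: "real \<Rightarrow> real" and a :: "nat \<Rightarrow> real"
  assumes "1 \<le> k" and "k \<le> n" and "0 < \<alpha>" and "\<alpha> < 1"
    and prob: "\<And>\<theta>. \<theta> \<in> \<Theta> \<Longrightarrow> prob_space (M \<theta>)"
    and rv: "\<And>\<theta> i. \<theta> \<in> \<Theta> \<Longrightarrow> i \<in> {1..n} \<Longrightarrow> P i \<in> borel_measurable (M \<theta>)"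
    and uniform: "\<And>\<theta> i. \<theta> \<in> \<Theta> \<Longrightarrow> i \<in> true_nulls n H \<theta> \<Longrightarrow>
        distr (M \<theta>) borel (P i) = uniform_measure lborel {0<..<1}"
    and mtp2: "\<And>\<theta>. \<theta> \<in> \<Theta> \<Longrightarrow> MTP2_vector (M \<theta>) (true_nulls n H \<theta>) P"
    and identical: "\<And>\<theta> \<theta>' J J'. \<theta> \<in> \<Theta> \<Longrightarrow> \<theta>' \<in> \<Theta> \<Longrightarrow>
        J \<subseteq> true_nulls n H \<theta> \<Longrightarrow> card J = k \<Longrightarrow>
        J' \<subseteq> true_nulls n H \<theta>' \<Longrightarrow> card J' = k \<Longrightarrow>
        joint_law (M \<theta>) P J = joint_law (M \<theta>') P J'"
    and G: "\<And>\<theta> J. \<theta> \<in> \<Theta> \<Longrightarrow> J \<subseteq> true_nulls n H \<theta> \<Longrightarrow> card J = k \<Longrightarrow>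
        G = cdf (distr (M \<theta>) borel (\<lambda>\<omega>. Max ((\<lambda>j. P j \<omega>) ` J)))"
    and a_mono: "mono_on {k..n} a"
    and a: "\<And>i. i \<in> {k..n} \<Longrightarrow> G (a i) = \<alpha> / real ((n + k - i) choose k)"
  shows "controls_kFWER k n \<Theta> M H (\<lambda>\<omega>. gen_stepup k n a (\<lambda>i. P i \<omega>)) \<alpha>"
  unfolding controls_kFWER_def
proof
  fix \<theta> assume \<theta>: "\<theta> \<in> \<Theta>"
  define I where "I = true_nulls n H \<theta>"
  define m where "m = card I"
  \<comment> \<open>With \<open>v\<close> true nulls rejected, at most \<open>n - m\<close> further
    rejections are possible, whence the rank \<open>n - m + v\<close>.\<close>
  define \<beta> where "\<beta> j = a (n - m + j)" for j
  interpret prob_space "M \<theta>" by (rule prob[OF \<theta>])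
  have I: "I \<subseteq> {1..n}" by (auto simp: I_def true_nulls_def)
  then have finI: "finite I" by (rule finite_subset) simp
  have "m \<le> n" using card_mono[OF _ I] by (simp add: m_def)
  have rvI [measurable]: "P i \<in> borel_measurable (M \<theta>)" if "i \<in> I" for i
    using rv[OF \<theta>] I that by blast
  let ?fwe = "{\<omega> \<in> space (M \<theta>). k \<le> card (gen_stepup k n a (\<lambda>i. P i \<omega>) \<inter> I)}"
  have "measure (M \<theta>) ?fwe \<le> \<alpha>"
  proof (cases "k \<le> m")
    case False
    have "card (R \<inter> I) \<le> m" for R unfolding m_def using finI by (intro card_mono) auto
    then have "?fwe = {}" using False by (auto dest: order_trans)
    then show ?thesis using \<open>0 < \<alpha>\<close> by (simp only: measure_empty)
  next
    case True
    have "measure (M \<theta>) ?fwe \<le> prob {\<omega>\<in>space (M \<theta>). stepup_ge I \<beta> k (\<lambda>i. P i \<omega>)}"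
    proof (rule finite_measure_mono)
      show "?fwe \<subseteq> {\<omega>\<in>space (M \<theta>). stepup_ge I \<beta> k (\<lambda>i. P i \<omega>)}"
        unfolding \<beta>_def m_def using gen_stepup_imp_stepup_ge[OF \<open>1 \<le> k\<close> I a_mono] by blast
      show "{\<omega>\<in>space (M \<theta>). stepup_ge I \<beta> k (\<lambda>i. P i \<omega>)} \<in> sets (M \<theta>)"
        using finI by measurable
    qed
    also have "\<dots> \<le> \<alpha>"
    proof (rule generalized_Simes[where G = G])
      show "MTP2_vector (M \<theta>) I P" unfolding I_def by (rule mtp2[OF \<theta>])
      show "mono_on {k..card I} \<beta>"
        using \<open>m \<le> n\<close> by (auto intro!: mono_onI mono_onD[OF a_mono] simp: \<beta>_def m_def) arith+
    next
      fix J u assume J: "J \<subseteq> I" "card J = k"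
      \<comment> \<open>\<open>k \<ge> 1\<close> makes \<open>J\<close> nonempty, so that the
        maximum is at most \<open>u\<close> exactly when every coordinate is.\<close>
      then have fin: "finite J" and "J \<noteq> {}" using \<open>1 \<le> k\<close> finI by (auto intro: finite_subset)
      have "G u = prob ((\<lambda>\<omega>. Max ((\<lambda>j. P j \<omega>) ` J)) -` {..u} \<inter> space (M \<theta>))"
        using G[OF \<theta>, of J] J rvI fin unfolding I_def[symmetric] cdf_def
        by (simp add: measure_distr borel_measurable_Max subset_iff)
      also have "(\<lambda>\<omega>. Max ((\<lambda>j. P j \<omega>) ` J)) -` {..u} \<inter> space (M \<theta>) = {\<omega>\<in>space (M \<theta>). \<forall>i\<in>J. P i \<omega> \<le> u}"
        using fin \<open>J \<noteq> {}\<close> by (simp add: vimage_def Int_def conj_commute)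
      finally show "prob {\<omega>\<in>space (M \<theta>). \<forall>i\<in>J. P i \<omega> \<le> u} = G u" by simp
    next
      fix j assume j: "j \<in> {k..card I}"
      then have G_\<beta>: "G (\<beta> j) = \<alpha> / ((m + k - j) choose k)"
      proof -
        \<comment> \<open>The shift cancels \<open>n\<close>: the binomial depends only on the
          number \<open>m\<close> of true nulls.\<close>
        have "n - m + j \<in> {k..n}" "n + k - (n - m + j) = m + k - j"
          using j \<open>m \<le> n\<close> by (auto simp: m_def)
        then show ?thesis using a[of "n - m + j"] by (simp only: \<beta>_def)
      qed
      have binom_pos: "0 < (m + k - j) choose k" "0 < m choose k"
        using j by (auto simp: m_def zero_less_binomial)
      then show "0 < G (\<beta> j)" using \<open>0 < \<alpha>\<close> by (simp add: G_\<beta>)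
      have "real (m choose k) \<le> real (j choose k) * real ((m + k - j) choose k)"
        using binomial_le_mult_binomial[of k j m] j
        unfolding of_nat_mult[symmetric] of_nat_le_iff by (simp add: m_def)
      then show "G (\<beta> j) \<le> \<alpha> * (j choose k) / (card I choose k)"
        using binom_pos \<open>0 < \<alpha>\<close> by (simp add: G_\<beta> m_def[symmetric] field_simps)
    qed (use finI True \<open>0 < \<alpha>\<close> in \<open>auto simp: m_def\<close>)
    finally show ?thesis .
  qed
  then show "kFWER k (M \<theta>) (true_nulls n H \<theta>) (\<lambda>\<omega>. gen_stepup k n a (\<lambda>i. P i \<omega>)) \<le> \<alpha>"
    by (simp add: kFWER_def I_def)
qed

end
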